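(* Let $(V,\|\cdot\|)$ be a normed vector space, $\varepsilon>0$, and $\Theta\subseteq V$ convex with $\mathrm{diam}(\Theta)\ge 12\varepsilon$. Let $k\ge1$ and let $m$ be an integer with $m\ge k\,(N(B(0,1),\|\cdot\|,1/4)+1)$. If each expert returns a ranking of her top $k$ candidates, then any universal committee of experts in $\Theta$ that guarantees, under some deterministic voting rule, a regret of at most $\varepsilon$ for any set of $m$ candidates in $\Theta$ has size at least $$M(\Theta,\|\cdot\|,24\varepsilon)\left(\frac{m}{k\,(N(B(0,1),\|\cdot\|,1/4)+1)}-1\right).$$
   Context: Model. There are $m$ candidates $[m]=\{1,\dots,m\}$; candidate $j$ has a location $c_j\in\Theta$ (locations may coincide) and a quality $q_j\in\mathbb{R}$. A committee is a finite list $E=\{e_1,\dots,e_n\}$ of expert locations in $\Theta$ (its size is $n$); "universal" means that it is fixed before, and independently of, the candidates. Write $d(x,y)=\|x-y\|$. Given the qualities, expert $i$ reports a ranking $\succ_i^k$ of her top $k$ candidates: for $h=1,\dots,k$, $\succ_i^k(h)\in\arg\max_{j\in[m]\setminus\{\succ_i^k(1),\dots,\succ_i^k(h-1)\}}\, q_j-d(e_i,c_j)$, with ties broken arbitrarily. A deterministic voting rule $f$ maps candidate locations $C$, expert locations $E$ and reported rankings $\succ^k=\{\succ_i^k\}_{i\in[n]}$ to a candidate in $[m]$. The committee $E$ guarantees regret at most $\varepsilon$ under $f$ for any set of $m$ candidates if for all candidate locations $C\subseteq\Theta$, all $q\in\mathbb{R}^m$ and all rankings $\succ^k$ that arise from $q$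 (under any tie-breaking), $\max_{j\in[m]}q_j-q_{f(C,E,\succ^k)}\le\varepsilon$. Covering and packing. $N(S,\|\cdot\|,\delta)$ is the minimum size of an (internal) $\delta$-cover of $S$, i.e. a set $X\subseteq S$ such that every $s\in S$ has some $x\in X$ with $\|s-x\|\le\delta$. $M(S,\|\cdot\|,\delta)$ is the maximum size of a $\delta$-packing of $S$, i.e. a set $X\subseteq S$ with $\|x-x'\|\ge\delta$ for all distinct $x,x'\in X$. $B(0,1)$ is the unit ball of $\|\cdot\|$ in $V$. *)

theory Defs
  imports "HOL-Analysis.Analysis"
begin

text \<open>The library's real-valued \<^const>\<open>diameter\<close> is unspecified on unbounded sets,
  whereas \<open>\<Theta>\<close> may be unbounded (with diameter \<open>\<infinity>\<close>).\<close>

definition ediameter :: "'a::metric_space set \<Rightarrow> ennreal" where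
  "ediameter S = (SUP (x, y) \<in> S \<times> S. ennreal (dist x y))"

text \<open>Internal cover: the centres are required to lie in \<open>S\<close>.\<close>

definition is_cover :: "'a::metric_space set \<Rightarrow> real \<Rightarrow> 'a set \<Rightarrow> bool" where
  "is_cover S \<delta> X \<longleftrightarrow> X \<subseteq> S \<and> (\<forall>s\<in>S. \<exists>x\<in>X. dist s x \<le> \<delta>)"

definition is_packing :: "'a::metric_space set \<Rightarrow> real \<Rightarrow> 'a set \<Rightarrow> bool" where
  "is_packing S \<delta> X \<longleftrightarrow> X \<subseteq> S \<and> (\<forall>x\<in>X. \<forall>x'\<in>X. x \<noteq> x' \<longrightarrow> dist x x' \<ge> \<delta>)"

text \<open>The covering number is \<open>\<infinity>\<close> if there is no finite cover, and the packing number is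
  \<open>\<infinity>\<close> if there are packings of unbounded size (subsets of packings are packings, so finite
  ones suffice).\<close>

definition covering_number :: "'a::metric_space set \<Rightarrow> real \<Rightarrow> enat" where
  "covering_number S \<delta> = (INF X \<in> {X. finite X \<and> is_cover S \<delta> X}. enat (card X))"

definition packing_number :: "'a::metric_space set \<Rightarrow> real \<Rightarrow> enat" where
  "packing_number S \<delta> = (SUP X \<in> {X. finite X \<and> is_packing S \<delta> X}. enat (card X))"

text \<open>The candidates are the indices \<open>0, \<dots>, m - 1\<close> of the list \<open>C\<close> of candidate locations,
  with \<open>m = length C\<close>; candidate \<open>j\<close> has location \<open>C ! j\<close> and quality \<open>q ! j\<close>. A top-\<open>k\<close> ranking
  is a list \<open>r\<close> of \<open>k\<close> candidates, the best one first; ties are broken arbitrarily, so several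
  rankings may be consistent with the same qualities.\<close>

definition top_ranking :: "nat \<Rightarrow> 'a::metric_space list \<Rightarrow> real list \<Rightarrow> 'a \<Rightarrow> nat list \<Rightarrow> bool" where
  "top_ranking k C q e r \<longleftrightarrow> length r = k \<and>
     (\<forall>h<k. is_arg_max (\<lambda>j. q ! j - dist e (C ! j))
                       (\<lambda>j. j \<in> {..<length C} - set (take h r)) (r ! h))"

text \<open>One ranking per expert, in the order of the committee.\<close>

definition reported_rankings ::
    "nat \<Rightarrow> 'a::metric_space list \<Rightarrow> real list \<Rightarrow> 'a list \<Rightarrow> nat list list \<Rightarrow> bool" where
  "reported_rankings k C q E R \<longleftrightarrow> list_all2 (top_ranking k C q) E R"

text \<open>Arguments: candidate locations, expert locations, reported rankings.\<close>

type_synonym 'a rule = "'a list \<Rightarrow> 'a list \<Rightarrow> nat list list \<Rightarrow> nat"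

definition voting_rule :: "nat \<Rightarrow> 'a rule \<Rightarrow> bool" where
  "voting_rule m f \<longleftrightarrow> (\<forall>C E R. length C = m \<longrightarrow> f C E R \<in> {..<m})"

definition guarantees_regret ::
    "'a::metric_space set \<Rightarrow> nat \<Rightarrow> nat \<Rightarrow> 'a list \<Rightarrow> 'a rule \<Rightarrow> real \<Rightarrow> bool" where
  "guarantees_regret \<Theta> m k E f \<epsilon> \<longleftrightarrow>
     (\<forall>C q R. length C = m \<and> set C \<subseteq> \<Theta> \<and> length q = m \<and> reported_rankings k C q E R
        \<longrightarrow> (MAX j\<in>{..<m}. q ! j) - q ! f C E R \<le> \<epsilon>)"

end

theory Submission
  imports Defs
begin

text \<open>Fix a packing point \<open>x\<close> and a point \<open>y \<in> \<Theta>\<close> at distance \<open>3 \<epsilon>\<close> from it. Put \<open>k\<close> candidates on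
  each expert within \<open>12 \<epsilon>\<close> of \<open>x\<close>, \<open>k\<close> candidates on each point of a \<open>6 \<epsilon>\<close>-cover of the part of
  \<open>\<Theta>\<close> on the sphere of radius \<open>12 \<epsilon>\<close> around \<open>x\<close>, and at least one on each of \<open>x\<close> and \<open>y\<close>. Let the
  quality be a cone of height \<open>2 \<epsilon>\<close> with apex at either \<open>x\<close> or \<open>y\<close>. Both profiles are 1-Lipschitz, so
  the near experts can report the candidates at their own location, whereas the far experts prefer
  the candidates on the sphere to all candidates inside the cones. Hence the two profiles admit the
  same reports, but no candidate has regret at most \<open>\<epsilon>\<close> in both. So the number of candidates
  bounds from below the number of experts within \<open>12 \<epsilon>\<close> of \<open>x\<close>, and these balls are disjoint for
  distinct packing points.\<close>

section \<open>Covering numbers of subsets of a ball\<close>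

lemma covering_number_attained:
  assumes "covering_number S \<delta> \<le> enat n"
  obtains X where "finite X" "is_cover S \<delta> X" "card X \<le> n"
proof -
  have "covering_number S \<delta> < enat (Suc n)"
    using assms by (simp add: le_less_trans)
  then show ?thesis
    unfolding covering_number_def using that by (auto simp: INF_less_iff)
qed

text \<open>The factor 2 is the price for moving the centres into \<open>S\<close>.\<close>

lemma covering_number_subset_cball:
  fixes S :: "'a::real_normed_vector set"
  assumes "S \<subseteq> cball a R" "R > 0"
  shows "covering_number S (2 * \<delta> * R) \<le> covering_number (cball (0::'a) 1) \<delta>"
  unfolding covering_number_def[of "cball 0 1"]
proof (rule INF_greatest)
  fix X assume "X \<in> {X. finite X \<and> is_cover (cball (0::'a) 1) \<delta> X}"
  then have X: "finite X" "\<And>s. norm s \<le> 1 \<Longrightarrow> \<exists>u\<in>X. dist s u \<le> \<delta>"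
    by (auto simp: is_cover_def)
  \<comment> \<open>Each centre \<open>u\<close> of the unit ball cover, rescaled, is traded for one
    chosen point of \<open>S\<close> near it; centres with no such point are dropped.\<close>
  define near where "near u s \<longleftrightarrow> s \<in> S \<and> dist s (a + R *\<^sub>R u) \<le> \<delta> * R" for u s
  define Y where "Y = (\<lambda>u. SOME s. near u s) ` {u \<in> X. \<exists>s. near u s}"
  have near_some: "near u (SOME s. near u s)" if "near u s" for u s
    using that by (rule someI)
  have "is_cover S (2 * \<delta> * R) Y"
    unfolding is_cover_def
  proof (intro conjI ballI)
    show "Y \<subseteq> S" using near_some by (auto simp: Y_def near_def)
    fix s assume "s \<in> S"
    then have "norm ((s - a) /\<^sub>R R) \<le> 1"
      using assms by (auto simp: dist_norm norm_minus_commute divide_inverse_commute[symmetric])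
    then obtain u where u: "u \<in> X" "dist ((s - a) /\<^sub>R R) u \<le> \<delta>" using X by blast
    have "s - (a + R *\<^sub>R u) = R *\<^sub>R ((s - a) /\<^sub>R R - u)"
      using assms by (simp add: scaleR_diff_right)
    then have "dist s (a + R *\<^sub>R u) = R * dist ((s - a) /\<^sub>R R) u"
      using assms by (simp add: dist_norm)
    then have su: "near u s"
      using u assms \<open>s \<in> S\<close> by (simp add: near_def mult.commute)
    define t where "t = (SOME s. near u s)"
    have "t \<in> Y" using su u by (auto simp: Y_def t_def)
    moreover have "near u t" using near_some[OF su] by (simp add: t_def)
    then have "dist s t \<le> 2 * \<delta> * R"
      using su dist_triangle2[of s t "a + R *\<^sub>R u"] by (simp add: near_def)
    ultimately show "\<exists>t\<in>Y. dist s t \<le> 2 * \<delta> * R" by blast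
  qed
  moreover have "finite Y" "card Y \<le> card X"
    using X(1) unfolding Y_def
    by (auto intro: order_trans[OF card_image_le card_mono])
  ultimately show "covering_number S (2 * \<delta> * R) \<le> enat (card X)"
    unfolding covering_number_def by (auto intro!: INF_lower2[of Y])
qed

section \<open>Rankings shared by two quality profiles\<close>

lemma ex_greedy_list:
  fixes v :: "'b \<Rightarrow> 'c::linorder"
  assumes "finite S" "k \<le> card S"
  shows "\<exists>r. length r = k \<and> (\<forall>h<k. is_arg_max v (\<lambda>j. j \<in> S - set (take h r)) (r ! h))"
  using assms(2)
proof (induction k)
  case (Suc k)
  then obtain r where r: "length r = k" "\<forall>h<k. is_arg_max v (\<lambda>j. j \<in> S - set (take h r)) (r ! h)"
    by auto
  have "card (set r) < card S" using Suc.prems r card_length[of r] by simp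
  then have "\<not> S \<subseteq> set r" by (metis List.finite_set card_mono not_le)
  then have "finite (v ` (S - set r))" "v ` (S - set r) \<noteq> {}" using assms(1) by auto
  from Max_in[OF this] obtain j where "j \<in> S - set r" "Max (v ` (S - set r)) = v j" by blast
  then have "is_arg_max v (\<lambda>j. j \<in> S - set r) j"
    using Max_ge[OF \<open>finite (v ` (S - set r))\<close>] by (fastforce simp: is_arg_max_linorder)
  then have "\<forall>h<Suc k. is_arg_max v (\<lambda>j. j \<in> S - set (take h (r @ [j]))) ((r @ [j]) ! h)"
    using r by (auto simp: nth_append less_Suc_eq)
  then show ?case using r by (intro exI[of _ "r @ [j]"]) simp
qed simp

text \<open>The greedy ranking for \<open>q\<close> inside \<open>S\<close> serves both profiles:
  \<open>mono\<close> carries its order over to \<open>q'\<close>. At each of the \<open>k\<close>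
  choices fewer than \<open>k\<close> candidates are used up, so some member of \<open>T\<close> is
  still available, and by \<open>dom\<close> it is at least as good as everything outside
  \<open>S\<close>.\<close>

lemma ex_common_top_ranking:
  assumes S: "S \<subseteq> {..<length C}" and T: "T \<subseteq> S" "k \<le> card T"
    and mono: "\<And>i j. i \<in> S \<Longrightarrow> j \<in> S \<Longrightarrow> q ! i - dist e (C ! i) \<le> q ! j - dist e (C ! j) \<Longrightarrow>
      q' ! i - dist e (C ! i) \<le> q' ! j - dist e (C ! j)"
    and dom: "\<And>j t. j < length C \<Longrightarrow> j \<notin> S \<Longrightarrow> t \<in> T \<Longrightarrow>
      q ! j - dist e (C ! j) \<le> q ! t - dist e (C ! t) \<and>
      q' ! j - dist e (C ! j) \<le> q' ! t - dist e (C ! t)"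
  shows "\<exists>r. top_ranking k C q e r \<and> top_ranking k C q' e r"
proof -
  define v v' where "v j = q ! j - dist e (C ! j)" and "v' j = q' ! j - dist e (C ! j)" for j
  have "finite S" using S finite_subset by blast
  then obtain r where r: "length r = k"
    "\<And>h. h < k \<Longrightarrow> is_arg_max v (\<lambda>j. j \<in> S - set (take h r)) (r ! h)"
    using ex_greedy_list[of S k v] T card_mono[of S T] by auto
  have "is_arg_max v (\<lambda>j. j \<in> {..<length C} - set (take h r)) (r ! h) \<and>
    is_arg_max v' (\<lambda>j. j \<in> {..<length C} - set (take h r)) (r ! h)" if "h < k" for h
  proof -
    have top: "r ! h \<in> S - set (take h r)"
      "\<And>j. j \<in> S - set (take h r) \<Longrightarrow> v j \<le> v (r ! h)"
      using r(2)[OF that] by (auto simp: is_arg_max_linorder)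
    then have top': "\<And>j. j \<in> S - set (take h r) \<Longrightarrow> v' j \<le> v' (r ! h)"
      using mono by (simp add: v_def v'_def)
    have "card (set (take h r)) < card T"
      using card_length[of "take h r"] T(2) that by simp
    then have "\<not> T \<subseteq> set (take h r)" by (metis List.finite_set card_mono not_le)
    then obtain t where "t \<in> T" "t \<in> S - set (take h r)" using T by blast
    then have "v j \<le> v (r ! h) \<and> v' j \<le> v' (r ! h)" if "j < length C" "j \<notin> S" for j
      using dom[OF that, of t] top(2)[of t] top'[of t] by (auto simp: v_def v'_def)
    then show ?thesis
      using top top' S by (auto simp: is_arg_max_linorder)
  qed
  then show ?thesis using r(1) unfolding top_ranking_def v_def v'_def by blast
qed

section \<open>Points at prescribed distances\<close>

lemma convex_ex_dist_eq:
  fixes S :: "'a::real_normed_vector set"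
  assumes "convex S" "x \<in> S" "z \<in> S" "0 \<le> r" "r \<le> dist x z"
  obtains y where "y \<in> S" "dist x y = r" "dist y z = dist x z - r"
proof (cases "x = z")
  case True
  then show ?thesis using assms that[of x] by auto
next
  case False
  define t where "t = r / dist x z"
  have t: "0 \<le> t" "t \<le> 1" "t * dist x z = r" using assms False by (auto simp: t_def)
  define y where "y = (1 - t) *\<^sub>R x + t *\<^sub>R z"
  have "y \<in> S" unfolding y_def using assms t by (intro convexD) auto
  moreover have "x - y = t *\<^sub>R (x - z)" "y - z = (1 - t) *\<^sub>R (x - z)"
    by (simp_all add: y_def algebra_simps)
  then have "dist x y = r" "dist y z = dist x z - r"
    using t by (simp_all add: dist_norm left_diff_distrib)
  ultimately show ?thesis by (rule that)
qed

text \<open>Two points more than \<open>2 * r\<close> apart cannot both be closer than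
  \<open>r\<close> to \<open>x\<close>. The gap between \<open>4 * r\<close> and
  \<open>2 * r\<close> allows for a supremum that is not attained.\<close>

lemma ex_dist_of_ediameter:
  assumes "ennreal (4 * r) \<le> ediameter S" "r > 0"
  obtains z where "z \<in> S" "r \<le> dist x z"
proof -
  have "ennreal (2 * r) < ediameter S"
    using assms by (intro less_le_trans[OF _ assms(1)] ennreal_lessI) auto
  then obtain a b where "a \<in> S" "b \<in> S" "2 * r < dist a b"
    unfolding ediameter_def less_SUP_iff using \<open>r > 0\<close> by (auto simp: ennreal_less_iff)
  then show ?thesis
    using that[of a] that[of b] dist_triangle3[of a b x] by linarith
qed

lemma length_concat_replicate:
  "length (concat (map (replicate k) xs)) = k * length xs"
  by (induction xs) auto

text \<open>Each occurrence of \<open>p\<close> in \<open>xs\<close> contributes \<open>k\<close>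
  copies, so its location alone can fill a top-\<open>k\<close> ranking.\<close>

lemma card_positions_concat_replicate:
  assumes "p \<in> set xs"
  shows "k \<le> card {j. j < length (concat (map (replicate k) xs) @ ys) \<and>
    (concat (map (replicate k) xs) @ ys) ! j = p}"
proof -
  have "k \<le> length (filter (\<lambda>z. z = p) (concat (map (replicate k) xs)))"
    using assms by (induction xs) auto
  also have "\<dots> \<le> length (filter (\<lambda>z. z = p) (concat (map (replicate k) xs) @ ys))" by simp
  finally show ?thesis by (simp only: length_filter_conv_card)
qed

section \<open>Lower bound on the experts near one point\<close>

definition peaked :: "real \<Rightarrow> 'a::metric_space \<Rightarrow> 'a \<Rightarrow> real" where
  "peaked h a p = max 0 (h - dist p a)"

text \<open>This is the 1-Lipschitz property of the cone: no candidate is strictly better for an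
  expert at \<open>e\<close> than one located at \<open>e\<close>.\<close>

lemma peaked_diff_le_dist: "peaked h a p - dist e p \<le> peaked h a e"
proof -
  have "h - dist p a - dist e p \<le> h - dist e a"
    using dist_triangle[of e a p] by simp
  then show ?thesis
    using zero_le_dist[of e p] unfolding peaked_def by linarith
qed

text \<open>The right-hand side counts the candidates of the construction: \<open>k\<close> per near
  expert and per cover point, and one each on \<open>x\<close> and \<open>y\<close>.\<close>

lemma num_candidates_less:
  fixes \<Theta> :: "'a::real_normed_vector set"
  assumes "\<epsilon> > 0" "convex \<Theta>" "ennreal (12 * \<epsilon>) \<le> ediameter \<Theta>"
    and N: "covering_number (cball (0::'a) 1) (1/4) \<le> enat N"
    and E: "set E \<subseteq> \<Theta>" and f: "voting_rule m f" "guarantees_regret \<Theta> m k E f \<epsilon>"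
    and x: "x \<in> \<Theta>"
  shows "m < k * (length (filter (\<lambda>e. dist x e < 12 * \<epsilon>) E) + N) + 2"
proof (rule ccontr)
  assume large: "\<not> ?thesis"
  \<comment> \<open>The distance \<open>3 * \<epsilon>\<close> exceeds
    \<open>2 * \<epsilon>\<close>, so no candidate is within \<open>\<epsilon>\<close> of both
    apexes; four times it is the assumed diameter.\<close>
  obtain z where z: "z \<in> \<Theta>" "3 * \<epsilon> \<le> dist x z"
    using ex_dist_of_ediameter[of "3 * \<epsilon>"] assms(1,3) by auto
  obtain y where y: "y \<in> \<Theta>" "dist x y = 3 * \<epsilon>"
    using convex_ex_dist_eq[OF assms(2) x z(1), of "3 * \<epsilon>"] z(2) \<open>\<epsilon> > 0\<close> by auto
  define Sph where "Sph = {p \<in> \<Theta>. dist x p = 12 * \<epsilon>}"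
  have "covering_number Sph (2 * (1/4) * (12 * \<epsilon>)) \<le> covering_number (cball (0::'a) 1) (1/4)"
    using \<open>\<epsilon> > 0\<close> by (intro covering_number_subset_cball[of _ x]) (auto simp: Sph_def)
  also note N
  finally have "covering_number Sph (6 * \<epsilon>) \<le> enat N" by simp
  then obtain Y where Y: "finite Y" "is_cover Sph (6 * \<epsilon>) Y" "card Y \<le> N"
    by (rule covering_number_attained)
  obtain ys where ys: "set ys = Y" "length ys = card Y"
    using Y(1) finite_distinct_list distinct_card by metis
  define near where "near = filter (\<lambda>e. dist x e < 12 * \<epsilon>) E"
  define ps where "ps = near @ ys"
  \<comment> \<open>The padding with \<open>x\<close> is nonempty by \<open>room\<close>
    below.\<close>
  define C where "C = concat (map (replicate k) ps) @ y # replicate (m - k * length ps - 1) x"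
  have "k * length ps \<le> k * (length near + N)"
    using ys Y(3) by (simp add: ps_def)
  then have room: "k * length ps + 2 \<le> m"
    using large unfolding near_def by linarith
  then have C: "length C = m" "x \<in> set C" "y \<in> set C"
    by (auto simp: C_def length_concat_replicate)
  have "set C \<subseteq> \<Theta>"
    using E Y(2) ys x y by (auto simp: C_def ps_def near_def is_cover_def Sph_def)
  define q where "q a = map (peaked (2 * \<epsilon>) a) C" for a
  have q: "q a ! j = peaked (2 * \<epsilon>) a (C ! j)" if "j < m" for a j
    using that C by (simp add: q_def)
  have cluster: "k \<le> card {j. j < m \<and> C ! j = p}" if "p \<in> set ps" for p
    using card_positions_concat_replicate[OF that, of k] C(1) unfolding C_def by metis
  have "\<exists>r. top_ranking k C (q x) e r \<and> top_ranking k C (q y) e r" if e: "e \<in> set E" for e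
  proof (cases "dist x e < 12 * \<epsilon>")
    case True
    let ?T = "{j. j < m \<and> C ! j = e}"
    show ?thesis
    \<comment> \<open>All candidates in \<open>?T\<close> share the location \<open>e\<close>, so
      they are tied in both profiles.\<close>
    proof (rule ex_common_top_ranking[of ?T C ?T])
      show "k \<le> card ?T" using cluster e True by (simp add: ps_def near_def)
    qed (use C(1) q peaked_diff_le_dist in auto)
  next
    case False
    \<comment> \<open>The segment from \<open>x\<close> to \<open>e\<close> crosses the sphere at
      \<open>p\<close>, and the cover point \<open>s\<close> near \<open>p\<close> is closer to
      \<open>e\<close> than \<open>x\<close> is by at least \<open>6 * \<epsilon>\<close>.\<close>
    then obtain p where "p \<in> \<Theta>" "dist x p = 12 * \<epsilon>" "dist p e = dist x e - 12 * \<epsilon>"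
      using convex_ex_dist_eq[OF assms(2) x, of e "12 * \<epsilon>"] e E \<open>\<epsilon> > 0\<close> by auto
    moreover from this obtain s where s: "s \<in> Y" "dist p s \<le> 6 * \<epsilon>"
      using Y(2) by (auto simp: is_cover_def Sph_def)
    ultimately have es: "dist e s \<le> dist x e - 6 * \<epsilon>"
      using dist_triangle3[of e s p] by linarith
    have xs: "dist x s = 12 * \<epsilon>" using s Y(2) by (auto simp: is_cover_def Sph_def)
    then have peaked_s: "peaked (2 * \<epsilon>) x s = 0" "peaked (2 * \<epsilon>) y s = 0"
      using y(2) \<open>\<epsilon> > 0\<close> dist_triangle[of x s y] by (auto simp: peaked_def dist_commute)
    \<comment> \<open>Both cones lie within \<open>3 * \<epsilon> + 2 * \<epsilon>\<close> of
      \<open>x\<close>, so inside them the value for \<open>e\<close> is at most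
      \<open>5 * \<epsilon> - dist x e\<close>, which is below the value at
      \<open>s\<close>.\<close>
    have hidden: "peaked (2 * \<epsilon>) a p - dist e p \<le> - dist e s"
      if "a \<in> {x, y}" "peaked (2 * \<epsilon>) x p \<noteq> 0 \<or> peaked (2 * \<epsilon>) y p \<noteq> 0" for a p
    proof -
      have "dist x e \<le> dist x p + dist e p" "dist x p \<le> dist x y + dist p y"
        by (metis dist_commute dist_triangle)+
      then show ?thesis
        using that es y(2) \<open>\<epsilon> > 0\<close>
        by (auto simp: peaked_def max_def dist_commute split: if_splits)
    qed
    let ?S = "{j. j < m \<and> peaked (2 * \<epsilon>) x (C ! j) = 0 \<and> peaked (2 * \<epsilon>) y (C ! j) = 0}"
    let ?T = "{j. j < m \<and> C ! j = s}"
    show ?thesis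
    \<comment> \<open>On \<open>?S\<close> both profiles vanish, so distance alone decides the
      order.\<close>
    proof (rule ex_common_top_ranking[of ?S C ?T])
      show "k \<le> card ?T" using cluster s ys by (simp add: ps_def)
    qed (use C(1) q peaked_s hidden in auto)
  qed
  then obtain rk where rk: "\<And>e. e \<in> set E \<Longrightarrow> top_ranking k C (q x) e (rk e)"
    "\<And>e. e \<in> set E \<Longrightarrow> top_ranking k C (q y) e (rk e)"
    by metis
  define R where "R = map rk E"
  have R: "reported_rankings k C (q x) E R" "reported_rankings k C (q y) E R"
    using rk by (auto simp: reported_rankings_def R_def list_all2_conv_all_nth)
  \<comment> \<open>The rule sees the same input for both profiles, hence elects the same
    \<open>j\<close>.\<close>
  define j where "j = f C E R"
  have "j < m" using f(1) C(1) by (simp add: voting_rule_def j_def)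
  \<comment> \<open>The candidate on the apex has quality \<open>2 * \<epsilon>\<close>, so the
    winner needs quality at least \<open>\<epsilon>\<close>, which the cone has only within
    \<open>\<epsilon>\<close> of its apex.\<close>
  have "dist (C ! j) a \<le> \<epsilon>" if "a \<in> {x, y}" for a
  proof -
    have "reported_rankings k C (q a) E R" "length (q a) = m"
      using R that C(1) by (auto simp: q_def)
    then have "(MAX i\<in>{..<m}. q a ! i) - q a ! j \<le> \<epsilon>"
      using f(2) C(1) \<open>set C \<subseteq> \<Theta>\<close> unfolding guarantees_regret_def j_def by blast
    moreover have "a \<in> set C" using that C(2,3) by blast
    then obtain i where i: "i < m" "C ! i = a"
      using C(1) by (auto simp: in_set_conv_nth)
    have "q a ! i \<le> (MAX i\<in>{..<m}. q a ! i)"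
      using i by (intro Max_ge) auto
    moreover have "q a ! i = 2 * \<epsilon>"
      using i \<open>\<epsilon> > 0\<close> by (simp add: q peaked_def)
    ultimately show ?thesis
      using \<open>j < m\<close> \<open>\<epsilon> > 0\<close> by (auto simp: q peaked_def max_def split: if_splits)
  qed
  then have "dist (C ! j) x \<le> \<epsilon>" "dist (C ! j) y \<le> \<epsilon>" by auto
  then show False
    using y(2) \<open>\<epsilon> > 0\<close> dist_triangle3[of x y "C ! j"] by linarith
qed

section \<open>Summation over a packing\<close>

text \<open>Open balls of radius \<open>r\<close> around the packing points are disjoint. Positions
  in \<open>E\<close> are counted, since experts may share a location.\<close>

lemma sum_near_packing_le:
  assumes "finite X" "is_packing \<Theta> (2 * r) X"
  shows "(\<Sum>x\<in>X. length (filter (\<lambda>e. dist x e < r) E)) \<le> length E"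
proof -
  have disj: "x = x'" if "x \<in> X" "x' \<in> X" "dist x e < r" "dist x' e < r" for x x' e
    using that assms(2) dist_triangle2[of x x' e] by (fastforce simp: is_packing_def)
  have "(\<Sum>x\<in>X. length (filter (\<lambda>e. dist x e < r) E)) =
    card (\<Union>x\<in>X. {i. i < length E \<and> dist x (E ! i) < r})"
    unfolding length_filter_conv_card using assms(1) disj
    by (intro card_UN_disjoint[symmetric]) auto
  also have "\<dots> \<le> card {..<length E}" by (intro card_mono) auto
  finally show ?thesis by simp
qed

theorem theorem5p1:
  fixes \<Theta> :: "'a::real_normed_vector set" and \<epsilon> :: real and k m :: nat and E :: "'a list"
  assumes "\<epsilon> > 0"
    and "convex \<Theta>"
    and "ediameter \<Theta> \<ge> ennreal (12 * \<epsilon>)"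
    and "k \<ge> 1"
    and "enat m \<ge> enat k * (covering_number (cball (0::'a) 1) (1/4) + 1)"
    and "set E \<subseteq> \<Theta>"
    and "\<exists>f. voting_rule m f \<and> guarantees_regret \<Theta> m k E f \<epsilon>"
  shows "ereal (real (length E)) \<ge>
    ereal_of_enat (packing_number \<Theta> (24 * \<epsilon>)) *
      (ereal (real m) /
         (ereal (real k) * (ereal_of_enat (covering_number (cball (0::'a) 1) (1/4)) + 1)) - 1)"
proof -
  \<comment> \<open>As \<open>k\<close> is positive, an infinite covering number would force
    \<open>m\<close> to be infinite.\<close>
  obtain N where N: "covering_number (cball (0::'a) 1) (1/4) = enat N"
    using assms(4,5) by (cases "covering_number (cball (0::'a) 1) (1/4)") auto
  have m: "k * (N + 1) \<le> m" using assms(5) unfolding N by (simp add: one_enat_def)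
  obtain f where f: "voting_rule m f" "guarantees_regret \<Theta> m k E f \<epsilon>" using assms(7) by blast
  define \<tau> where "\<tau> = real m / (real k * (real N + 1)) - 1"
  have kN: "real k * (real N + 1) > 0" using \<open>k \<ge> 1\<close> by simp
  have "real (k * (N + 1)) \<le> real m" using m by (rule of_nat_mono)
  then have "\<tau> \<ge> 0" using kN by (simp add: \<tau>_def field_simps)
  have near: "\<tau> \<le> real (length (filter (\<lambda>e. dist x e < 12 * \<epsilon>) E))" if "x \<in> \<Theta>" for x
  proof -
    define n where "n = length (filter (\<lambda>e. dist x e < 12 * \<epsilon>) E)"
    have "m < k * (n + N) + 2"
      unfolding n_def using assms(1-3,6) f that N by (intro num_candidates_less) auto
    \<comment> \<open>The summand 2 is absorbed half by \<open>k\<close> and half by the strict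
      inequality.\<close>
    also have "\<dots> \<le> k * (n + N + 1) + 1" using \<open>k \<ge> 1\<close> by simp
    also have "\<dots> \<le> k * ((N + 1) * (n + 1)) + 1" by (simp add: algebra_simps)
    finally have "m \<le> k * ((N + 1) * (n + 1))" by simp
    then have "real m \<le> real (k * ((N + 1) * (n + 1)))" by (rule of_nat_mono)
    then have "real m \<le> (real n + 1) * (real k * (real N + 1))" by (simp add: algebra_simps)
    then show ?thesis
      unfolding \<tau>_def n_def[symmetric] diff_le_eq using kN by (subst pos_divide_le_eq) auto
  qed
  have packing: "real (card X) * \<tau> \<le> real (length E)"
    if "finite X" "is_packing \<Theta> (24 * \<epsilon>) X" for X
  proof -
    have "real (card X) * \<tau> \<le> (\<Sum>x\<in>X. real (length (filter (\<lambda>e. dist x e < 12 * \<epsilon>) E)))"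
      using that near by (intro sum_bounded_below) (auto simp: is_packing_def)
    also have "\<dots> \<le> real (length E)"
      using sum_near_packing_le[of X \<Theta> "12 * \<epsilon>" E] that by (simp flip: of_nat_sum)
    finally show ?thesis .
  qed
  have "ereal_of_enat (packing_number \<Theta> (24 * \<epsilon>)) * ereal \<tau> \<le> ereal (real (length E))"
  \<comment> \<open>For \<open>\<tau> = 0\<close> the packing number may be infinite, but its
    product with 0 is 0. For \<open>\<tau> > 0\<close> the bound \<open>b\<close> on all finite
    packings makes it finite.\<close>
  proof (cases "\<tau> = 0")
    case False
    then have "\<tau> > 0" using \<open>\<tau> \<ge> 0\<close> by simp
    define b where "b = nat \<lfloor>real (length E) / \<tau>\<rfloor>"
    have "card X \<le> b" if "finite X" "is_packing \<Theta> (24 * \<epsilon>) X" for X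
      using packing[OF that] \<open>\<tau> > 0\<close> by (simp add: b_def le_nat_floor field_simps)
    then have "packing_number \<Theta> (24 * \<epsilon>) \<le> enat b"
      unfolding packing_number_def by (auto intro!: SUP_least)
    then obtain M where M: "packing_number \<Theta> (24 * \<epsilon>) = enat M" "M \<le> b"
      by (cases "packing_number \<Theta> (24 * \<epsilon>)") auto
    have "real M \<le> real (length E) / \<tau>"
      using M(2) \<open>\<tau> > 0\<close> unfolding b_def by (simp add: le_nat_iff le_floor_iff)
    then show ?thesis using M \<open>\<tau> > 0\<close> by (simp add: field_simps)
  qed (simp flip: zero_ereal_def)
  moreover have "ereal (real m) /
      (ereal (real k) * (ereal_of_enat (covering_number (cball (0::'a) 1) (1/4)) + 1)) - 1 = ereal \<tau>"
    unfolding N \<tau>_def using \<open>k \<ge> 1\<close> by (simp add: one_ereal_def)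
  ultimately show ?thesis by simp
qed

end
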